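(* Let $k\ge2$ be an integer, let $T$ be the infinite rooted $k$-ary tree, let $1<p<\infty$ and $$w(x)=\sum_{j=0}^{\infty}k^{(p-1)j}\chi_{T_{j}}(x).$$ Then $\|Mf\|_{L^{p,\infty}(w)}\lesssim\|f\|_{L^{p}(w)}$ holds for all functions $f$ on $T$, but the estimate $$\|Mf\|_{L^{p}(w)}\lesssim\|f\|_{L^{p}(w)}$$ does not hold, i.e. there is no finite constant $C$ such that $\|Mf\|_{L^p(w)}\le C\|f\|_{L^p(w)}$ for all $f$.
   Context: For an integer $k\ge2$, $T$ denotes (the vertex set of) the infinite rooted $k$-ary tree, in which every vertex has exactly $k$ children; $d(x,y)$ is the number of edges on the unique path between $x$ and $y$. $T_0$ is the set consisting of the root, and $T_j$ is the set of children of vertices in $T_{j-1}$ for $j\ge1$; $\chi_A$ is the indicator function of $A$. $|A|$ is the cardinality of $A$ and $B(x,r)=\{y\in T: d(x,y)\le r\}$. The centered maximal function is $Mf(x)=\sup_{r\in\mathbb{N}\cup\{0\}}\frac{1}{|B(x,r)|}\sum_{y\in B(x,r)}|f(y)|$. For $A\subset T$, $w(A)=\sum_{x\in A}w(x)$. $\|f\|_{L^p(w)}=\left(\sum_{x\in T}|f(x)|^p w(x)\right)^{1/p}$ and $\|f\|_{L^{p,\infty}(w)}=\sup_{\lambda>0}\lambda\, w(\{x\in T:|f(x)|>\lambda\})^{1/p}$. The notation $A\lesssim B$ means $A\le CB$ for a finite constant $C$ independent of $f$. *)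

theory Defs
  imports "HOL-Analysis.Analysis"
begin

text \<open>
  The infinite rooted k-ary tree is realised on words over \<open>{..<k}\<close>.  A word is read from the
  vertex up to the root: the root is \<open>[]\<close>, and the children of \<open>x\<close> are the words \<open>i # x\<close>, \<open>i < k\<close>.
\<close>

definition tree :: "nat \<Rightarrow> nat list set" where
  "tree k = lists {..<k}"

definition children :: "nat \<Rightarrow> nat list \<Rightarrow> nat list set" where
  "children k x = (\<lambda>i. i # x) ` {..<k}"

fun tree_level :: "nat \<Rightarrow> nat \<Rightarrow> nat list set" where
  "tree_level k 0 = {[]}"
| "tree_level k (Suc j) = (\<Union>x\<in>tree_level k j. children k x)"

definition tree_adj :: "nat \<Rightarrow> nat list \<Rightarrow> nat list \<Rightarrow> bool" where
  "tree_adj k x y \<longleftrightarrow> y \<in> children k x \<or> x \<in> children k y"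

definition tree_path :: "nat \<Rightarrow> nat list \<Rightarrow> nat list list \<Rightarrow> nat list \<Rightarrow> bool" where
  "tree_path k x ps y \<longleftrightarrow>
     ps \<noteq> [] \<and> hd ps = x \<and> last ps = y \<and> set ps \<subseteq> tree k \<and> distinct ps \<and>
     successively (tree_adj k) ps"

text \<open>A path is recorded by its list of vertices, so it has one edge fewer than entries.\<close>

definition tree_dist :: "nat \<Rightarrow> nat list \<Rightarrow> nat list \<Rightarrow> nat" where
  "tree_dist k x y = length (THE ps. tree_path k x ps y) - 1"

definition tree_ball :: "nat \<Rightarrow> nat list \<Rightarrow> nat \<Rightarrow> nat list set" where
  "tree_ball k x r = {y \<in> tree k. tree_dist k x y \<le> r}"

text \<open>
  The functions \<open>f\<close> are arbitrary, so the supremum and the norms below may be infinite; they take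
  values in \<^typ>\<open>ennreal\<close>.  By the Gelfand--Mazur theorem the class \<^class>\<open>real_normed_field\<close>
  covers exactly real and complex scalars.
\<close>

definition maximal :: "nat \<Rightarrow> (nat list \<Rightarrow> 'a::real_normed_field) \<Rightarrow> nat list \<Rightarrow> ennreal" where
  "maximal k f x =
     (SUP r::nat. ennreal ((\<Sum>y\<in>tree_ball k x r. norm (f y)) / real (card (tree_ball k x r))))"

text \<open>Power with a positive real exponent on \<open>[0, \<infinity>]\<close>.\<close>

definition epowr :: "ennreal \<Rightarrow> real \<Rightarrow> ennreal" where
  "epowr a p = (if a = \<infinity> then \<infinity> else ennreal (enn2real a powr p))"

definition wmeasure :: "(nat list \<Rightarrow> real) \<Rightarrow> nat list set \<Rightarrow> ennreal" where
  "wmeasure w A = (\<Sum>\<^sub>\<infinity>x\<in>A. ennreal (w x))"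

text \<open>Both norms take the absolute value of the function as argument.\<close>

definition Lp_norm :: "nat \<Rightarrow> real \<Rightarrow> (nat list \<Rightarrow> real) \<Rightarrow> (nat list \<Rightarrow> ennreal) \<Rightarrow> ennreal" where
  "Lp_norm k p w g = epowr (\<Sum>\<^sub>\<infinity>x\<in>tree k. epowr (g x) p * ennreal (w x)) (1 / p)"

definition weak_Lp_norm :: "nat \<Rightarrow> real \<Rightarrow> (nat list \<Rightarrow> real) \<Rightarrow> (nat list \<Rightarrow> ennreal) \<Rightarrow> ennreal" where
  "weak_Lp_norm k p w g =
     (SUP t\<in>{0::real<..}. ennreal t * epowr (wmeasure w {x \<in> tree k. g x > ennreal t}) (1 / p))"

definition level_weight :: "nat \<Rightarrow> real \<Rightarrow> nat list \<Rightarrow> real" where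
  "level_weight k p x = (\<Sum>j. real k powr ((p - 1) * real j) * indicator (tree_level k j) x)"

end

theory Submission
  imports Defs "HOL-Library.Sublist"
begin

text \<open>
  A ball of radius \<open>r\<close> has between \<open>k\<^sup>r\<close> and \<open>C k\<^sup>r\<close> vertices, and \<open>B(x, r)\<close> is covered by the
  sets of \<open>j\<close>-th generation descendants of the \<open>i\<close>-th ancestor of \<open>x\<close> with \<open>i + j \<le> r\<close>.  Write
  \<open>S\<^sub>j z\<close> for the sum of \<open>|f|\<close> over the \<open>j\<close>-th generation descendants of \<open>z\<close>.  As the sum of
  \<open>k powr (i + j / 2)\<close> over \<open>i + j \<le> r\<close> is \<open>O(k\<^sup>r)\<close>, \<open>Mf(x) > t\<close> forces
  \<open>S\<^sub>j z > c t k powr (i + j / 2)\<close> for some \<open>i\<close>, \<open>j\<close>, where \<open>z\<close> is the \<open>i\<close>-th ancestor of \<open>x\<close>.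
  The \<open>i\<close>-th generation descendants of \<open>z\<close> have total weight \<open>w z k powr (p i)\<close>, so those \<open>x\<close> that
  are charged to \<open>z\<close> and \<open>j\<close> weigh at most a constant times
  \<open>w z (S\<^sub>j z / (t k powr (j / 2))) powr p\<close>.  By Hoelder's inequality the sum of this over \<open>z\<close> is at
  most \<open>t powr -p k powr (-p j / 2)\<close> times the \<open>p\<close>-th power of the norm of \<open>f\<close>, which is summable
  in \<open>j\<close>.

  For \<open>f\<close> the indicator of the root, \<open>Mf\<close> is at least a constant times \<open>k powr -n\<close> on the \<open>n\<close>-th
  level, whose weight is \<open>k powr (p n)\<close>; so every level contributes at least a fixed amount to the
  strong norm.
\<close>

section \<open>Distance and balls in the tree\<close>

lemma Cons_in_tree_iff: "a # x \<in> tree k \<longleftrightarrow> a < k \<and> x \<in> tree k"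
  by (auto simp: tree_def)

lemma append_in_tree_iff: "u @ x \<in> tree k \<longleftrightarrow> u \<in> tree k \<and> x \<in> tree k"
  by (auto simp: tree_def)

lemma Nil_in_tree: "[] \<in> tree k"
  by (simp add: tree_def)

lemma drop_in_tree: "x \<in> tree k \<Longrightarrow> drop i x \<in> tree k"
  by (auto simp: tree_def dest: in_set_dropD)

lemma tree_adj_iff: "tree_adj k x y \<longleftrightarrow> (\<exists>i<k. y = i # x \<or> x = i # y)"
  by (auto simp: tree_adj_def children_def)

lemma tree_adj_sym: "tree_adj k x y \<longleftrightarrow> tree_adj k y x"
  by (auto simp: tree_adj_def)

text \<open>A subtree can only be entered or left through its topmost vertex; this determines the
  first step of a path from its endpoints.\<close>

lemma walk_stays_below_child:
  assumes "successively (tree_adj k) (z # zs)" "x \<notin> set (z # zs)" "suffix (i # x) z"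
  shows "\<forall>y\<in>set (z # zs). suffix (i # x) y"
  using assms
proof (induction zs arbitrary: z)
  case (Cons z' zs)
  from Cons.prems(1) have adj: "tree_adj k z z'" and s: "successively (tree_adj k) (z' # zs)"
    by simp_all
  from adj obtain j where "z' = j # z \<or> z = j # z'"
    by (auto simp: tree_adj_iff)
  \<comment> \<open>Moving up from \<open>z\<close> leaves the subtree of \<open>i # x\<close> only
    if \<open>z = i # x\<close>, and then \<open>z' = x\<close>, which the walk avoids.\<close>
  hence "suffix (i # x) z'"
    using Cons.prems(2,3) by (auto simp: suffix_Cons)
  thus ?case
    using Cons.IH[OF s] Cons.prems(2,3) by auto
qed simp

lemma walk_stays_outside:
  assumes "successively (tree_adj k) (z # zs)" "x \<notin> set (z # zs)" "\<not> suffix x z"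
  shows "\<forall>y\<in>set (z # zs). \<not> suffix x y"
  using assms
proof (induction zs arbitrary: z)
  case (Cons z' zs)
  from Cons.prems(1) have adj: "tree_adj k z z'" and s: "successively (tree_adj k) (z' # zs)"
    by simp_all
  from adj obtain j where "z' = j # z \<or> z = j # z'"
    by (auto simp: tree_adj_iff)
  hence "\<not> suffix x z'"
    using Cons.prems(2,3) by (auto simp: suffix_Cons)
  thus ?case
    using Cons.IH[OF s] Cons.prems(2,3) by auto
qed simp

lemma path_first_step:
  assumes "successively (tree_adj k) (x # z # zs)" "distinct (x # z # zs)"
  defines "y \<equiv> last (z # zs)"
  shows "(\<exists>i. z = i # x \<and> suffix (i # x) y) \<or> z = tl x \<and> \<not> suffix x y"
proof -
  have yin: "y \<in> set (z # zs)"
    unfolding y_def by (rule last_in_set) simp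
  have s: "successively (tree_adj k) (z # zs)" and n: "x \<notin> set (z # zs)"
    and adj: "tree_adj k x z"
    using assms(1,2) by auto
  from adj obtain i where "z = i # x \<or> x = i # z"
    by (auto simp: tree_adj_iff)
  thus ?thesis
  proof
    assume z: "z = i # x"
    thus ?thesis
      using walk_stays_below_child[OF s n, of i] yin by auto
  next
    assume x: "x = i # z"
    have "\<not> suffix x z"
      using x by (auto dest: suffix_length_le)
    thus ?thesis
      using walk_stays_outside[OF s n] yin x by auto
  qed
qed

lemma path_unique:
  assumes "successively (tree_adj k) ps" "distinct ps" "ps \<noteq> []"
    "successively (tree_adj k) qs" "distinct qs" "qs \<noteq> []"
    "hd ps = hd qs" "last ps = last qs"
  shows "ps = qs"
  using assms
proof (induction ps arbitrary: qs)
  case (Cons x ps)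
  obtain qs' where qs: "qs = x # qs'"
    using Cons.prems by (cases qs) auto
  show ?case
  proof (cases ps)
    case Nil
    with Cons.prems qs show ?thesis
      by (cases qs' rule: rev_cases) auto
  next
    case (Cons z ps')
    note ps = this
    show ?thesis
    proof (cases qs')
      case Nil
      with Cons.prems qs ps show ?thesis
        by (metis distinct.simps(2) last.simps last_in_set list.distinct(1) list.sel(1))
    next
      case (Cons z' qs'')
      have l: "last (z # ps') = last (z' # qs'')"
        using Cons.prems ps Cons qs by simp
      have 1: "(\<exists>i. z = i # x \<and> suffix (i # x) (last (z # ps'))) \<or>
          z = tl x \<and> \<not> suffix x (last (z # ps'))"
        using path_first_step Cons.prems ps by blast
      have 2: "(\<exists>i. z' = i # x \<and> suffix (i # x) (last (z' # qs''))) \<or>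
          z' = tl x \<and> \<not> suffix x (last (z' # qs''))"
        using path_first_step Cons.prems qs Cons by blast
      \<comment> \<open>The endpoint is the same, so both paths fall under the same alternative;
        going down, the letter \<open>i\<close> is read off from the suffix of the endpoint of
        length \<open>length x + 1\<close>.\<close>
      have "z = z'"
        using 1 2 unfolding l by (auto simp: suffix_def)
      hence "ps = qs'"
        using Cons.prems ps Cons qs by (intro Cons.IH) auto
      thus ?thesis
        using qs by simp
    qed
  qed
qed simp

text \<open>Uniqueness of paths resolves the definite description, so any explicit path computes the
  distance.\<close>

lemma tree_dist_eq:
  assumes "tree_path k x ps y"
  shows "tree_dist k x y = length ps - 1"
proof -
  have "(THE ps. tree_path k x ps y) = ps"
    using assms by (intro the_equality) (metis tree_path_def path_unique)+
  thus ?thesis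
    by (simp add: tree_dist_def)
qed

lemma tree_path_rev: "tree_path k x ps y \<Longrightarrow> tree_path k y (rev ps) x"
  by (auto simp: tree_path_def hd_rev last_rev tree_adj_sym[of k])

text \<open>Prepending \<open>x\<close> could repeat a vertex; if \<open>x\<close> already lies on
  the path, the path is cut there instead. Hence only an upper bound on the length.\<close>

lemma tree_path_step:
  assumes "tree_path k x' ps y" "tree_adj k x x'" "x \<in> tree k"
  obtains qs where "tree_path k x qs y" "length qs \<le> length ps + 1"
proof (cases "x \<in> set ps")
  case True
  then obtain as bs where "ps = as @ x # bs"
    by (auto simp: in_set_conv_decomp)
  thus ?thesis
    using assms by (intro that[of "x # bs"]) (auto simp: tree_path_def successively_append_iff)
next
  case False
  thus ?thesis
    using assms by (intro that[of "x # ps"]) (auto simp: tree_path_def successively_Cons)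
qed

lemma tree_path_descend:
  assumes "tree_path k x ps y" "u @ x \<in> tree k"
  shows "\<exists>qs. tree_path k (u @ x) qs y \<and> length qs \<le> length u + length ps"
  using assms
proof (induction u)
  case (Cons a u)
  then obtain qs where qs: "tree_path k (u @ x) qs y" "length qs \<le> length u + length ps"
    by (auto simp: Cons_in_tree_iff)
  have "tree_adj k ((a # u) @ x) (u @ x)"
    using Cons.prems(2) by (auto simp: tree_adj_iff Cons_in_tree_iff)
  from tree_path_step[OF qs(1) this Cons.prems(2)] qs(2) show ?case
    by (metis (no_types, lifting) Suc_eq_plus1 add_Suc add_le_mono1 le_trans length_Cons)
qed auto

lemma tree_path_refl: "x \<in> tree k \<Longrightarrow> tree_path k x [x] x"
  by (auto simp: tree_path_def)

text \<open>The path goes through the root: one from \<open>y\<close> to \<open>[]\<close> is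
  reversed and then extended to \<open>x\<close>, with shortcuts made by
  \<open>tree_path_step\<close>.\<close>

lemma tree_path_exists:
  assumes "x \<in> tree k" "y \<in> tree k"
  obtains ps where "tree_path k x ps y"
proof -
  obtain qs where "tree_path k y qs []"
    using tree_path_descend[OF tree_path_refl[OF Nil_in_tree], of y k] assms by auto
  from tree_path_descend[OF tree_path_rev[OF this], of x] assms show ?thesis
    using that by auto
qed

lemma tree_dist_ancestor_le:
  assumes "u @ x \<in> tree k"
  shows "tree_dist k (u @ x) x \<le> length u" "tree_dist k x (u @ x) \<le> length u"
proof -
  obtain qs where qs: "tree_path k (u @ x) qs x" "length qs \<le> length u + 1"
    using tree_path_descend[OF tree_path_refl, of x k u] assms by (auto simp: append_in_tree_iff)
  show "tree_dist k (u @ x) x \<le> length u" "tree_dist k x (u @ x) \<le> length u"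
    using qs(2) tree_dist_eq[OF qs(1)] tree_dist_eq[OF tree_path_rev[OF qs(1)]] by auto
qed

section \<open>Generations of descendants and the covering of balls\<close>

definition descendants :: "nat \<Rightarrow> nat \<Rightarrow> nat list \<Rightarrow> nat list set" where
  "descendants k j z = (\<lambda>u. u @ z) ` {u. set u \<subseteq> {..<k} \<and> length u = j}"

lemma finite_descendants: "finite (descendants k j z)"
  unfolding descendants_def by (intro finite_imageI finite_lists_length_eq) simp

lemma card_descendants: "card (descendants k j z) = k ^ j"
  unfolding descendants_def
  by (subst card_image) (auto simp: inj_on_def card_lists_length_eq)

text \<open>Words are read towards the root, so \<open>drop j\<close> yields the \<open>j\<close>-th
  ancestor. The length condition matters because \<open>drop\<close> stops at the root.\<close>

lemma mem_descendants_iff: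
  assumes "z \<in> tree k"
  shows "y \<in> descendants k j z \<longleftrightarrow> y \<in> tree k \<and> j \<le> length y \<and> drop j y = z"
proof
  assume "y \<in> tree k \<and> j \<le> length y \<and> drop j y = z"
  thus "y \<in> descendants k j z"
    unfolding descendants_def
    by (intro image_eqI[of _ _ "take j y"]) (auto simp: tree_def dest: in_set_takeD)
qed (use assms in \<open>auto simp: descendants_def tree_def\<close>)


text \<open>Induction on the walk, adding a step at its start. A step up from \<open>x\<close>
  increases \<open>i\<close>; a step down decreases \<open>i\<close>, or increases \<open>j\<close>
  if \<open>i = 0\<close>. So \<open>i + j\<close> grows by at most one per step.\<close>

lemma walk_last_descendant:
  assumes "successively (tree_adj k) (x # ps)" "set (x # ps) \<subseteq> tree k"
  shows "\<exists>i j. i \<le> length x \<and> i + j \<le> length ps \<and> last (x # ps) \<in> descendants k j (drop i x)"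
  using assms
proof (induction ps arbitrary: x)
  case Nil
  thus ?case
    by (intro exI[of _ 0]) (auto simp: mem_descendants_iff)
next
  case (Cons z ps)
  have "successively (tree_adj k) (z # ps)" "set (z # ps) \<subseteq> tree k"
    using Cons.prems by auto
  from Cons.IH[OF this] obtain i j where ij: "i \<le> length z" "i + j \<le> length ps"
    "last (z # ps) \<in> descendants k j (drop i z)"
    by blast
  from Cons.prems have zt: "z \<in> tree k" and xt: "x \<in> tree k" and "tree_adj k x z"
    by auto
  then obtain a where a: "z = a # x \<or> x = a # z"
    by (auto simp: tree_adj_iff)
  have y: "last (z # ps) \<in> tree k" "j \<le> length (last (z # ps))" "drop j (last (z # ps)) = drop i z"
    using ij(3) by (auto simp: mem_descendants_iff[OF drop_in_tree[OF zt]] simp del: last.simps)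
  have l: "last (x # z # ps) = last (z # ps)"
    by simp
  show ?case
  proof (cases "z = a # x \<and> i = 0")
    case True
    have "last (z # ps) \<in> descendants k (Suc j) (drop 0 x)"
      unfolding mem_descendants_iff[OF drop_in_tree[OF xt]] using True y
      by (metis Suc_leI diff_is_0_eq drop0 drop_Suc drop_eq_Nil le_neq_implies_less length_drop
          list.discI list.sel(3) tl_drop)
    thus ?thesis
      unfolding l using ij by (intro exI[of _ 0] exI[of _ "Suc j"]) simp
  next
    case False
    show ?thesis
    proof (cases "z = a # x")
      case True
      thus ?thesis
        unfolding l using ij False
        by (intro exI[of _ "i - 1"] exI[of _ j]) (auto simp: drop_Cons' simp del: last.simps)
    next
      case False
      thus ?thesis
        unfolding l using a ij
        by (intro exI[of _ "Suc i"] exI[of _ j]) (auto simp del: last.simps)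
    qed
  qed
qed

lemma tree_ball_subset:
  assumes "x \<in> tree k"
  shows "tree_ball k x r \<subseteq>
    (\<Union>(i, j)\<in>{(i, j). i \<le> length x \<and> i + j \<le> r}. descendants k j (drop i x))"
proof
  fix y assume y: "y \<in> tree_ball k x r"
  then obtain ps where ps: "tree_path k x ps y"
    using assms tree_path_exists[of x k y] by (auto simp: tree_ball_def)
  obtain qs where qs: "ps = x # qs"
    using ps by (cases ps) (auto simp: tree_path_def)
  have "length qs \<le> r"
    using y tree_dist_eq[OF ps] qs by (simp add: tree_ball_def)
  moreover obtain i j where "i \<le> length x" "i + j \<le> length qs" "y \<in> descendants k j (drop i x)"
    using walk_last_descendant[of k x qs] ps unfolding qs tree_path_def by (auto simp del: last.simps)
  ultimately show "y \<in> (\<Union>(i, j)\<in>{(i, j). i \<le> length x \<and> i + j \<le> r}. descendants k j (drop i x))"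
    by (intro UN_I[of "(i, j)"]) auto
qed

lemma descendants_subset_tree_ball:
  assumes "x \<in> tree k"
  shows "descendants k r x \<subseteq> tree_ball k x r"
  using tree_dist_ancestor_le(2)[of _ x k] assms
  by (auto simp: descendants_def tree_ball_def append_in_tree_iff tree_def subset_iff)

lemma Nil_in_tree_ball: "x \<in> tree k \<Longrightarrow> [] \<in> tree_ball k x (length x)"
  using tree_dist_ancestor_le(1)[of x "[]" k] by (simp add: tree_ball_def Nil_in_tree)

lemma finite_index_pairs: "finite {(i, j). i + j \<le> (r::nat)}"
  by (rule finite_subset[of _ "{..r} \<times> {..r}"]) auto

lemma finite_tree_ball: "x \<in> tree k \<Longrightarrow> finite (tree_ball k x r)"
  by (rule finite_subset[OF tree_ball_subset])
    (auto intro!: finite_descendants finite_subset[OF _ finite_index_pairs[of r]])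

lemma card_tree_ball_ge:
  assumes "x \<in> tree k"
  shows "k ^ r \<le> card (tree_ball k x r)"
  using card_mono[OF finite_tree_ball descendants_subset_tree_ball, OF assms assms, of r]
  by (simp add: card_descendants)

lemma sum_UN_le:
  fixes g :: "'a \<Rightarrow> real"
  assumes "finite I" "\<And>i. i \<in> I \<Longrightarrow> finite (A i)" "\<And>x. g x \<ge> 0"
  shows "sum g (\<Union>i\<in>I. A i) \<le> (\<Sum>i\<in>I. sum g (A i))"
  using assms(1,2)
proof (induction rule: finite_induct)
  case (insert i I)
  have "sum g (\<Union>i\<in>insert i I. A i) \<le> sum g (A i) + sum g (\<Union>i\<in>I. A i)"
    using insert.prems insert.hyps(1) assms(3) by (simp add: sum_Un sum_nonneg)
  thus ?case
    using insert by simp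
qed simp

lemma sum_tree_ball_le:
  fixes g :: "nat list \<Rightarrow> real"
  assumes x: "x \<in> tree k" and g: "\<And>y. g y \<ge> 0"
  shows "(\<Sum>y\<in>tree_ball k x r. g y) \<le>
    (\<Sum>(i, j)\<in>{(i, j). i \<le> length x \<and> i + j \<le> r}. \<Sum>y\<in>descendants k j (drop i x). g y)"
proof -
  define I where "I = {(i, j). i \<le> length x \<and> i + j \<le> r}"
  have fin: "finite I"
    unfolding I_def by (rule finite_subset[OF _ finite_index_pairs[of r]]) auto
  have "(\<Sum>y\<in>tree_ball k x r. g y) \<le> (\<Sum>y\<in>(\<Union>(i, j)\<in>I. descendants k j (drop i x)). g y)"
    using tree_ball_subset[OF x, of r] g fin
    by (intro sum_mono2) (auto simp: I_def[symmetric] finite_descendants)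
  also have "\<dots> \<le> (\<Sum>c\<in>I. \<Sum>y\<in>(case c of (i, j) \<Rightarrow> descendants k j (drop i x)). g y)"
    using fin g by (intro sum_UN_le) (auto simp: finite_descendants)
  finally show ?thesis
    unfolding I_def by (simp add: case_prod_unfold)
qed

section \<open>The weak-type estimate\<close>

lemma sum_power_le_geometric:
  fixes q :: real
  assumes "q > 1"
  shows "(\<Sum>i\<le>m. q ^ i) \<le> q / (q - 1) * q ^ m"
proof (induction m)
  case 0
  show ?case
    using assms by (simp add: field_simps)
next
  case (Suc m)
  have "(\<Sum>i\<le>Suc m. q ^ i) \<le> q / (q - 1) * q ^ m + q ^ Suc m"
    using Suc by simp
  also have "\<dots> = q / (q - 1) * q ^ Suc m"
    using assms by (simp add: field_simps)
  finally show ?case .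
qed

text \<open>For \<open>s = sqrt k\<close> the summand is \<open>k powr (i + j / 2)\<close>. The
  inner sum over \<open>j\<close> is comparable to its last term \<open>s ^ (r - i)\<close>; this
  leaves \<open>s ^ (r + i)\<close>, whose sum is again dominated by the last term, at
  \<open>i = r\<close>.\<close>

lemma sum_index_pairs_le:
  fixes s :: real
  assumes "s > 1"
  shows "(\<Sum>(i, j)\<in>{(i, j). i + j \<le> r}. s ^ (2 * i + j)) \<le> (s / (s - 1))\<^sup>2 * s ^ (2 * r)"
proof -
  define K where "K = s / (s - 1)"
  have K: "K \<ge> 0"
    using assms by (simp add: K_def)
  have "{(i, j). i + j \<le> r} = (SIGMA i:{..r}. {..r - i})"
    by auto
  hence "(\<Sum>(i, j)\<in>{(i, j). i + j \<le> r}. s ^ (2 * i + j)) = (\<Sum>i\<le>r. \<Sum>j\<le>r - i. s ^ (2 * i + j))"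
    by (simp add: sum.Sigma)
  also have "\<dots> = (\<Sum>i\<le>r. s ^ (2 * i) * (\<Sum>j\<le>r - i. s ^ j))"
    by (simp add: power_add sum_distrib_left)
  also have "\<dots> \<le> (\<Sum>i\<le>r. s ^ (2 * i) * (K * s ^ (r - i)))"
    using assms sum_power_le_geometric[OF assms] unfolding K_def
    by (intro sum_mono mult_left_mono) auto
  also have "\<dots> = (\<Sum>i\<le>r. K * s ^ r * s ^ i)"
  proof (intro sum.cong refl)
    fix i assume "i \<in> {..r}"
    hence "s ^ (2 * i) * s ^ (r - i) = s ^ r * s ^ i"
      by (simp add: add.commute flip: power_add)
    thus "s ^ (2 * i) * (K * s ^ (r - i)) = K * s ^ r * s ^ i"
      by (simp add: algebra_simps)
  qed
  also have "\<dots> = K * s ^ r * (\<Sum>i\<le>r. s ^ i)"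
    by (simp add: sum_distrib_left)
  also have "\<dots> \<le> K * s ^ r * (K * s ^ r)"
    using assms K sum_power_le_geometric[OF assms] unfolding K_def[symmetric]
    by (intro mult_left_mono) auto
  also have "\<dots> = K\<^sup>2 * s ^ (2 * r)"
    by (simp add: power2_eq_square mult_2 power_add)
  finally show ?thesis
    unfolding K_def .
qed

text \<open>Serves both for counting the ball (\<open>g = 1\<close>) and for averages of
  \<open>norm (f y)\<close>. Extending the sum to all pairs with \<open>i + j \<le> r\<close> makes
  the bound independent of the level of \<open>x\<close>.\<close>

lemma sum_tree_ball_le_of_descendants:
  fixes g :: "nat list \<Rightarrow> real"
  assumes x: "x \<in> tree k" and g: "\<And>y. g y \<ge> 0" and c: "c \<ge> 0"
    and le: "\<And>i j. i \<le> length x \<Longrightarrow>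
      sum g (descendants k j (drop i x)) \<le> c * h (i, j)"
    and h: "\<And>e. h e \<ge> 0"
  shows "sum g (tree_ball k x r) \<le> c * (\<Sum>e\<in>{(i, j). i + j \<le> r}. h e)"
proof -
  have "sum g (tree_ball k x r) \<le>
      (\<Sum>(i, j)\<in>{(i, j). i \<le> length x \<and> i + j \<le> r}. sum g (descendants k j (drop i x)))"
    using sum_tree_ball_le[OF x g] .
  also have "\<dots> \<le> (\<Sum>(i, j)\<in>{(i, j). i \<le> length x \<and> i + j \<le> r}. c * h (i, j))"
    using le by (intro sum_mono) auto
  also have "\<dots> \<le> (\<Sum>(i, j)\<in>{(i, j). i + j \<le> r}. c * h (i, j))"
    using h c by (intro sum_mono2 finite_index_pairs) auto
  finally show ?thesis
    by (simp add: sum_distrib_left case_prod_unfold)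
qed

lemma card_tree_ball_le:
  assumes k: "k \<ge> 2" and x: "x \<in> tree k"
  defines "s \<equiv> sqrt (real k)"
  shows "real (card (tree_ball k x r)) \<le> (s / (s - 1))\<^sup>2 * real k ^ r"
proof -
  have s: "s > 1" and s2: "real k = s ^ 2"
    using k by (auto simp: s_def)
  have "real (card (tree_ball k x r)) = sum (\<lambda>_. 1) (tree_ball k x r)"
    by simp
  \<comment> \<open>The exact count \<open>k ^ j = s ^ (2 * j)\<close> is padded by
    \<open>s ^ i\<close>; after exchanging \<open>i\<close> and \<open>j\<close> this is the sum
    already estimated.\<close>
  also have "\<dots> \<le> 1 * (\<Sum>c\<in>{(i, j). i + j \<le> r}. s ^ (2 * snd c + fst c))"
  proof (rule sum_tree_ball_le_of_descendants[OF x])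
    fix i j :: nat
    have "real k ^ j = s ^ (2 * j)"
      by (simp add: s2 power_mult)
    also have "\<dots> \<le> s ^ (2 * j + i)"
      using s by (intro power_increasing) auto
    finally show "sum (\<lambda>_. 1) (descendants k j (drop i x)) \<le> 1 * s ^ (2 * snd (i, j) + fst (i, j))"
      by (simp add: card_descendants)
  qed (use s in auto)
  also have "\<dots> = (\<Sum>(i, j)\<in>{(i, j). i + j \<le> r}. s ^ (2 * i + j))"
    by (simp, rule sum.reindex_bij_witness[of _ prod.swap prod.swap]) auto
  also have "\<dots> \<le> (s / (s - 1))\<^sup>2 * real k ^ r"
    using sum_index_pairs_le[OF s, of r] by (simp add: s2 power_mult)
  finally show ?thesis .
qed

text \<open>Pigeonhole: if no generation exceeded its threshold, the thresholds would add up to at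
  most \<open>t * k ^ r\<close>, hence at most \<open>t\<close> times the cardinality of the ball,
  for every \<open>r\<close>. The thresholds do not involve \<open>r\<close>, which removes the
  supremum.\<close>

lemma maximal_gt_imp:
  fixes f :: "nat list \<Rightarrow> 'a::real_normed_field"
  assumes k: "k \<ge> 2" and x: "x \<in> tree k" and t: "t > 0" and gt: "maximal k f x > ennreal t"
  defines "s \<equiv> sqrt (real k)"
  shows "\<exists>i j. i \<le> length x \<and>
    t / (s / (s - 1))\<^sup>2 * s ^ (2 * i + j) < (\<Sum>y\<in>descendants k j (drop i x). norm (f y))"
proof (rule ccontr)
  have s: "s > 1" and s2: "real k = s ^ 2"
    using k by (auto simp: s_def)
  define K where "K = (s / (s - 1))\<^sup>2"
  have K: "K > 0"
    using s by (simp add: K_def)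
  obtain r where r: "ennreal t <
      ennreal ((\<Sum>y\<in>tree_ball k x r. norm (f y)) / real (card (tree_ball k x r)))"
    using gt by (auto simp: maximal_def less_SUP_iff)
  have "k ^ r > 0"
    using k by simp
  hence B: "real (card (tree_ball k x r)) \<ge> real k ^ r" "card (tree_ball k x r) > 0"
    using card_tree_ball_ge[OF x, of r] by (simp flip: of_nat_power, linarith)
  assume "\<not> ?thesis"
  hence le: "(\<Sum>y\<in>descendants k j (drop i x). norm (f y)) \<le> t / K * s ^ (2 * i + j)"
    if "i \<le> length x" for i j
    using that unfolding K_def by (meson not_le)
  have "(\<Sum>y\<in>tree_ball k x r. norm (f y)) \<le>
      t / K * (\<Sum>c\<in>{(i, j). i + j \<le> r}. s ^ (2 * fst c + snd c))"
    using t K le s by (intro sum_tree_ball_le_of_descendants[OF x]) auto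
  also have "\<dots> \<le> t / K * (K * s ^ (2 * r))"
    using t K sum_index_pairs_le[OF s, of r]
    by (intro mult_left_mono) (auto simp: K_def case_prod_unfold)
  also have "\<dots> \<le> t * real (card (tree_ball k x r))"
    using B t K by (simp add: s2 power_mult)
  finally have "(\<Sum>y\<in>tree_ball k x r. norm (f y)) / real (card (tree_ball k x r)) \<le> t"
    using B by (simp add: field_simps)
  with r t show False
    by (metis ennreal_leI not_le)
qed

text \<open>Closed form of \<open>level_weight\<close> at vertices of the tree, where a single term
  of the series survives.\<close>

definition tree_weight :: "nat \<Rightarrow> real \<Rightarrow> nat list \<Rightarrow> real" where
  "tree_weight k p x = real k powr ((p - 1) * real (length x))"

text \<open>There are \<open>k ^ i\<close> descendants, each heavier than \<open>z\<close> by the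
  factor \<open>k powr ((p - 1) * i)\<close>.\<close>

lemma sum_weight_descendants:
  assumes "k > 0"
  shows "sum (tree_weight k p) (descendants k i z) = tree_weight k p z * (real k powr p) ^ i"
proof -
  have "sum (tree_weight k p) (descendants k i z) =
      (\<Sum>x\<in>descendants k i z. real k powr ((p - 1) * real (length z + i)))"
    by (intro sum.cong) (auto simp: descendants_def tree_weight_def add.commute)
  also have "\<dots> = real k powr real i * real k powr ((p - 1) * real (length z + i))"
    using assms by (simp add: card_descendants powr_realpow)
  also have "\<dots> = tree_weight k p z * (real k powr p) ^ i"
    using assms
    by (simp add: tree_weight_def powr_realpow[symmetric] powr_powr powr_add[symmetric] algebra_simps)
  finally show ?thesis .
qed

text \<open>The step without a strong-type analogue: there all \<open>i\<close> may contribute equally.\<close>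

lemma sum_powr_power_le:
  assumes k: "k \<ge> 2" and p: "p > 0" and "finite I" and "R \<ge> 0" and I: "\<And>i. i \<in> I \<Longrightarrow> real k ^ i < R"
  defines "q \<equiv> real k powr p"
  shows "(\<Sum>i\<in>I. q ^ i) \<le> q / (q - 1) * R powr p"
proof -
  have q: "q > 1"
    using k p by (simp add: q_def)
  show ?thesis
  proof (cases "I = {}")
    case False
    \<comment> \<open>The geometric sum is governed by its largest exponent, and
      \<open>k ^ m < R\<close> bounds \<open>q ^ m = (k ^ m) powr p\<close> by
      \<open>R powr p\<close>.\<close>
    define m where "m = Max I"
    have m: "m \<in> I" "\<And>i. i \<in> I \<Longrightarrow> i \<le> m"
      using False \<open>finite I\<close> by (auto simp: m_def)
    have "(\<Sum>i\<in>I. q ^ i) \<le> (\<Sum>i\<le>m. q ^ i)"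
      using m q by (intro sum_mono2) auto
    also have "\<dots> \<le> q / (q - 1) * q ^ m"
      by (rule sum_power_le_geometric[OF q])
    also have "q ^ m = (real k ^ m) powr p"
      using k by (simp add: q_def powr_realpow[symmetric] powr_powr mult.commute)
    also have "q / (q - 1) * (real k ^ m) powr p \<le> q / (q - 1) * R powr p"
      using q I[OF m(1)] p by (intro mult_left_mono powr_mono2) auto
    finally show ?thesis .
  qed (use q in auto)
qed

text \<open>\<open>powr_convex\<close> excludes the point \<open>0\<close>, hence the restriction to the positive terms.\<close>

lemma powr_sum_le:
  fixes g :: "'a \<Rightarrow> real"
  assumes "finite A" "p \<ge> 1" "\<And>x. x \<in> A \<Longrightarrow> g x \<ge> 0"
  shows "(\<Sum>x\<in>A. g x) powr p \<le> real (card A) powr (p - 1) * (\<Sum>x\<in>A. g x powr p)"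
proof -
  define A' where "A' = {x \<in> A. g x > 0}"
  have A': "finite A'" "A' \<subseteq> A"
    using assms by (auto simp: A'_def)
  have "g x = 0" if "x \<in> A - A'" for x
    using that assms(3)[of x] by (auto simp: A'_def)
  hence sums: "(\<Sum>x\<in>A. g x) = (\<Sum>x\<in>A'. g x)" "(\<Sum>x\<in>A. g x powr p) = (\<Sum>x\<in>A'. g x powr p)"
    using assms A' by (auto intro!: sum.mono_neutral_right)
  show ?thesis
  proof (cases "A' = {}")
    case False
    define n where "n = real (card A')"
    have n: "n > 0"
      using False A' by (simp add: n_def card_gt_0_iff)
    \<comment> \<open>Jensen's inequality with equal weights \<open>1 / n\<close>.\<close>
    have "(\<Sum>x\<in>A'. (1 / n) *\<^sub>R g x) powr p \<le> (\<Sum>x\<in>A'. (1 / n) * g x powr p)"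
      using n False A'
      by (intro convex_on_sum[OF _ _ powr_convex[OF assms(2)]]) (auto simp: n_def A'_def)
    hence "(1 / n) powr p * (\<Sum>x\<in>A'. g x) powr p \<le> (1 / n) * (\<Sum>x\<in>A'. g x powr p)"
      using n by (simp add: sum_distrib_left[symmetric] powr_mult powr_divide sum_nonneg A'_def
        flip: sum_divide_distrib)
    hence "n powr p * ((1 / n) powr p * (\<Sum>x\<in>A'. g x) powr p) \<le>
        n powr p * ((1 / n) * (\<Sum>x\<in>A'. g x powr p))"
      by (intro mult_left_mono) auto
    hence "(\<Sum>x\<in>A'. g x) powr p \<le> n powr (p - 1) * (\<Sum>x\<in>A'. g x powr p)"
      using n by (simp add: powr_divide powr_diff)
    also have "\<dots> \<le> real (card A) powr (p - 1) * (\<Sum>x\<in>A'. g x powr p)"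
      using assms A' by (intro mult_right_mono powr_mono2 sum_nonneg) (auto simp: n_def card_mono)
    finally show ?thesis
      unfolding sums .
  qed (simp add: sums)
qed

lemma finite_tree_below: "finite {x \<in> tree k. length x < n}"
  by (rule finite_subset[OF _ finite_lists_length_le[of "{..<k}" n]]) (auto simp: tree_def)

text \<open>The Hoelder factor \<open>(k ^ j) powr (p - 1)\<close> is exactly the ratio of the
  weights of a \<open>j\<close>-th generation descendant and of \<open>z\<close>, so the weight
  moves onto the descendants without loss. Their sets are disjoint for different \<open>z\<close>,
  so each \<open>y\<close> is counted at most once.\<close>

lemma sum_weight_powr_descendants_le:
  fixes g :: "nat list \<Rightarrow> real"
  assumes k: "k > 0" and p: "p \<ge> 1" and g: "\<And>y. g y \<ge> 0"
  shows "(\<Sum>z | z \<in> tree k \<and> length z < n. tree_weight k p z * sum g (descendants k j z) powr p)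
    \<le> (\<Sum>y | y \<in> tree k \<and> length y < n + j. tree_weight k p y * g y powr p)"
proof -
  let ?T = "\<lambda>n. {z \<in> tree k. length z < n}"
  have "tree_weight k p z * sum g (descendants k j z) powr p \<le>
      (\<Sum>y\<in>descendants k j z. tree_weight k p y * g y powr p)" for z
  proof -
    have "tree_weight k p z * sum g (descendants k j z) powr p \<le> tree_weight k p z *
        (real (card (descendants k j z)) powr (p - 1) * (\<Sum>y\<in>descendants k j z. g y powr p))"
      using p g by (intro mult_left_mono powr_sum_le finite_descendants) (auto simp: tree_weight_def)
    also have "\<dots> = (\<Sum>y\<in>descendants k j z.
        tree_weight k p z * (real k powr real j) powr (p - 1) * g y powr p)"
      using k by (simp add: card_descendants sum_distrib_left powr_realpow mult.assoc)
    also have "\<dots> = (\<Sum>y\<in>descendants k j z. tree_weight k p y * g y powr p)"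
      using k by (intro sum.cong refl)
        (auto simp: tree_weight_def powr_powr descendants_def powr_add[symmetric] algebra_simps)
    finally show ?thesis .
  qed
  hence "(\<Sum>z\<in>?T n. tree_weight k p z * sum g (descendants k j z) powr p) \<le>
      (\<Sum>z\<in>?T n. \<Sum>y\<in>descendants k j z. tree_weight k p y * g y powr p)"
    by (intro sum_mono)
  also have "\<dots> = (\<Sum>y\<in>(\<Union>z\<in>?T n. descendants k j z). tree_weight k p y * g y powr p)"
    by (rule sum.UNION_disjoint[symmetric], simp add: finite_tree_below,
        simp add: finite_descendants, auto simp: descendants_def)
  also have "\<dots> \<le> (\<Sum>y\<in>?T (n + j). tree_weight k p y * g y powr p)"
    by (intro sum_mono2 finite_tree_below)
      (auto simp: descendants_def tree_def tree_weight_def)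
  finally show ?thesis .
qed

text \<open>Finite \<open>F\<close> and finitely many levels keep all sums real, even when the norm
  of \<open>f\<close> is infinite. Only \<open>n\<close> depends on \<open>F\<close>;
  \<open>C\<close> does not.\<close>

lemma weak_type_finite:
  assumes k: "k \<ge> 2" and p: "p > 1"
  obtains C where "C > 0"
    "\<And>(f :: nat list \<Rightarrow> 'a::real_normed_field) t F. t > 0 \<Longrightarrow> finite F \<Longrightarrow>
      F \<subseteq> {x \<in> tree k. maximal k f x > ennreal t} \<Longrightarrow>
      \<exists>n. t powr p * sum (tree_weight k p) F \<le>
        C * (\<Sum>y | y \<in> tree k \<and> length y < n. tree_weight k p y * norm (f y) powr p)"
proof -
  define s where "s = sqrt (real k)"
  have s: "s > 1" and s2: "real k = s ^ 2"
    using k by (auto simp: s_def)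
  define K where "K = (s / (s - 1))\<^sup>2"
  define q where "q = real k powr p"
  \<comment> \<open>The decay per generation: \<open>b ^ j = k powr (- p * j / 2)\<close>.\<close>
  define b where "b = s powr (-p)"
  have K: "K > 0"
    using s by (simp add: K_def)
  have q: "q > 1"
    using k p by (simp add: q_def)
  have b: "0 < b" "b < 1"
    using s p by (auto simp: b_def powr_less_one)
  \<comment> \<open>The factors come from the geometric sum over \<open>i\<close>, from the
    threshold in \<open>maximal_gt_imp\<close>, and from the geometric sum over
    \<open>j\<close>.\<close>
  define C where "C = q / (q - 1) * K powr p * (1 / (1 - b))"
  have C: "C > 0"
    using q K b by (simp add: C_def)
  show ?thesis
  proof (rule that[OF C])
    fix f :: "nat list \<Rightarrow> 'a" and t :: real and F
    assume t: "t > 0" and F: "finite F" "F \<subseteq> {x \<in> tree k. maximal k f x > ennreal t}"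
    let ?T = "\<lambda>n. {z \<in> tree k. length z < n}"
    define S where "S = (\<lambda>j z. \<Sum>y\<in>descendants k j z. norm (f y))"
    \<comment> \<open>Chosen so that exceeding the threshold of \<open>maximal_gt_imp\<close>
      becomes \<open>k ^ i < R j z\<close>.\<close>
    define R where "R = (\<lambda>j z. K * S j z / (t * s ^ j))"
    have S0: "S j z \<ge> 0" for j z
      by (simp add: S_def sum_nonneg)
    have R0: "R j z \<ge> 0" for j z
      using K S0 t s by (simp add: R_def)
    have "\<forall>x\<in>F. \<exists>i j. i \<le> length x \<and> real k ^ i < R j (drop i x)"
    proof
      fix x assume "x \<in> F"
      then obtain i j where "i \<le> length x" "t / K * s ^ (2 * i + j) < S j (drop i x)"
        using maximal_gt_imp[OF k _ t, of x f] F(2) unfolding S_def K_def s_def by blast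
      moreover have "real k ^ i < R j (drop i x) \<longleftrightarrow> t / K * s ^ (2 * i + j) < S j (drop i x)"
      proof -
        have "s ^ (2 * i + j) = real k ^ i * s ^ j"
          by (simp add: s2 power_add power_mult)
        thus ?thesis
          using t K s by (simp add: R_def field_simps)
      qed
      ultimately show "\<exists>i j. i \<le> length x \<and> real k ^ i < R j (drop i x)"
        by blast
    qed
    then obtain a c where ac: "\<And>x. x \<in> F \<Longrightarrow> a x \<le> length x"
      "\<And>x. x \<in> F \<Longrightarrow> real k ^ a x < R (c x) (drop (a x) x)"
      by metis
    \<comment> \<open>Exceeds every \<open>c x\<close> and \<open>length x\<close>, hence also
      \<open>a x\<close>; the inserted \<open>0\<close> covers empty \<open>F\<close>.\<close>
    define N where "N = Suc (Max (insert 0 (c ` F \<union> length ` F)))"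
    have N: "c x < N" "length x < N" if "x \<in> F" for x
      using that F(1) by (auto simp: N_def less_Suc_eq_le intro!: Max_ge)
    define I where "I = (\<lambda>j z. {i. i < N \<and> real k ^ i < R j z})"
    \<comment> \<open>Each \<open>x\<close> is charged to its ancestor \<open>drop (a x) x\<close>
      and to the generation \<open>c x\<close>.\<close>
    have sub: "F \<subseteq> (\<Union>j\<in>{..<N}. \<Union>z\<in>?T N. \<Union>i\<in>I j z. descendants k i z)"
    proof
      fix x assume x: "x \<in> F"
      hence xt: "x \<in> tree k"
        using F(2) by auto
      have "x \<in> descendants k (a x) (drop (a x) x)"
        using ac(1)[OF x] xt by (simp add: mem_descendants_iff drop_in_tree)
      moreover have "a x \<in> I (c x) (drop (a x) x)"
        using ac[OF x] N[OF x] by (simp add: I_def)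
      moreover have "drop (a x) x \<in> ?T N"
        using xt N[OF x] by (simp add: drop_in_tree)
      ultimately show "x \<in> (\<Union>j\<in>{..<N}. \<Union>z\<in>?T N. \<Union>i\<in>I j z. descendants k i z)"
        using N(1)[OF x] by blast
    qed
    have finI: "finite (I j z)" for j z
      by (simp add: I_def)
    have w0: "tree_weight k p x \<ge> 0" for x
      by (simp add: tree_weight_def)
    note fin = finI finite_tree_below finite_descendants
    define G where "G = (\<Sum>y\<in>?T (N + N). tree_weight k p y * norm (f y) powr p)"
    have G0: "G \<ge> 0"
      unfolding G_def using w0 by (intro sum_nonneg mult_nonneg_nonneg) auto
    \<comment> \<open>The height \<open>t\<close> cancels, and the factor \<open>s ^ j\<close> in
      the denominator of \<open>R\<close> supplies the decay that makes the sum over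
      \<open>j\<close> converge.\<close>
    have tR: "t powr p * R j z powr p = K powr p * b ^ j * S j z powr p" for j z
    proof -
      have "R j z powr p = K powr p * S j z powr p / (t powr p * (s ^ j) powr p)"
        using K S0 t s unfolding R_def by (simp add: powr_divide powr_mult)
      moreover have "b ^ j = 1 / (s ^ j) powr p"
        using s b by (simp add: b_def powr_realpow[symmetric] powr_powr mult.commute
          flip: powr_minus_divide)
      ultimately show ?thesis
        using t by simp
    qed
    have "sum (tree_weight k p) F \<le>
        sum (tree_weight k p) (\<Union>j\<in>{..<N}. \<Union>z\<in>?T N. \<Union>i\<in>I j z. descendants k i z)"
      using sub w0 by (intro sum_mono2 finite_UN_I fin) auto
    also have "\<dots> \<le> (\<Sum>j<N. \<Sum>z\<in>?T N. \<Sum>i\<in>I j z. sum (tree_weight k p) (descendants k i z))"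
      by (rule order.trans[OF sum_UN_le], simp, intro finite_UN_I fin, rule w0, rule sum_mono,
          rule order.trans[OF sum_UN_le], rule fin, intro finite_UN_I fin, rule w0, rule sum_mono,
          rule sum_UN_le, rule fin, rule fin, rule w0)
    also have "\<dots> = (\<Sum>j<N. \<Sum>z\<in>?T N. tree_weight k p z * (\<Sum>i\<in>I j z. q ^ i))"
      using k by (simp add: sum_weight_descendants sum_distrib_left q_def)
    also have "\<dots> \<le> (\<Sum>j<N. \<Sum>z\<in>?T N. tree_weight k p z * (q / (q - 1) * R j z powr p))"
      unfolding q_def using k p w0 finI R0
      by (intro sum_mono mult_left_mono sum_powr_power_le) (auto simp: I_def)
    finally have "t powr p * sum (tree_weight k p) F \<le>
        t powr p * (\<Sum>j<N. \<Sum>z\<in>?T N. tree_weight k p z * (q / (q - 1) * R j z powr p))"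
      by (rule mult_left_mono) simp
    also have "\<dots> = (\<Sum>j<N. \<Sum>z\<in>?T N. q / (q - 1) * tree_weight k p z * (t powr p * R j z powr p))"
      by (simp add: sum_distrib_left mult_ac)
    also have "\<dots> = (\<Sum>j<N. q / (q - 1) * K powr p * b ^ j *
        (\<Sum>z\<in>?T N. tree_weight k p z * S j z powr p))"
      unfolding tR by (simp add: sum_distrib_left mult_ac)
    also have "\<dots> \<le> (\<Sum>j<N. q / (q - 1) * K powr p * b ^ j * G)"
    proof (intro sum_mono mult_left_mono)
      fix j assume j: "j \<in> {..<N}"
      have "(\<Sum>z\<in>?T N. tree_weight k p z * S j z powr p) \<le>
          (\<Sum>y\<in>?T (N + j). tree_weight k p y * norm (f y) powr p)"
        unfolding S_def using k p by (intro sum_weight_powr_descendants_le) auto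
      also have "\<dots> \<le> G"
        unfolding G_def using j w0 by (intro sum_mono2 finite_tree_below) auto
      finally show "(\<Sum>z\<in>?T N. tree_weight k p z * S j z powr p) \<le> G" .
    qed (use q b in auto)
    also have "\<dots> = q / (q - 1) * K powr p * (\<Sum>j<N. b ^ j) * G"
      by (simp add: sum_distrib_left sum_distrib_right)
    also have "\<dots> \<le> C * G"
    proof -
      have "(\<Sum>j<N. b ^ j) \<le> 1 / (1 - b)"
        using b by (simp add: sum_gp_strict divide_right_mono)
      thus ?thesis
        unfolding C_def using q G0 by (intro mult_right_mono mult_left_mono) auto
    qed
    finally show "\<exists>n. t powr p * sum (tree_weight k p) F \<le>
        C * (\<Sum>y\<in>?T n. tree_weight k p y * norm (f y) powr p)"
      unfolding G_def by blast
  qed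
qed

section \<open>From finite real sums to norms with values in \<open>ennreal\<close>\<close>

lemma tree_level_eq: "tree_level k j = {x \<in> tree k. length x = j}"
proof (induction j)
  case 0
  show ?case
    by (auto simp: Nil_in_tree)
next
  case (Suc j)
  show ?case
  proof (intro set_eqI)
    fix x show "x \<in> tree_level k (Suc j) \<longleftrightarrow> x \<in> {x \<in> tree k. length x = Suc j}"
      by (cases x) (auto simp: Suc.IH children_def Cons_in_tree_iff image_iff)
  qed
qed

lemma level_weight_eq:
  assumes "x \<in> tree k"
  shows "level_weight k p x = tree_weight k p x"
proof -
  have "level_weight k p x =
      (\<Sum>j\<in>{length x}. real k powr ((p - 1) * real j) * indicator (tree_level k j) x)"
    unfolding level_weight_def by (rule suminf_finite) (auto simp: tree_level_eq)
  thus ?thesis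
    using assms by (simp add: tree_weight_def tree_level_eq)
qed

lemma epowr_ennreal: "a \<ge> 0 \<Longrightarrow> epowr (ennreal a) p = ennreal (a powr p)"
  by (simp add: epowr_def)

lemma epowr_mono:
  assumes "a \<le> b" "p \<ge> 0"
  shows "epowr a p \<le> epowr b p"
proof (cases b)
  case (real b')
  then obtain a' where "a = ennreal a'" "a' \<ge> 0"
    using assms(1) by (cases a) (auto simp: top_unique)
  thus ?thesis
    using real assms by (auto simp: epowr_ennreal intro!: ennreal_leI powr_mono2)
qed (simp add: epowr_def)

text \<open>Taking \<open>p\<close>-th roots. If \<open>b\<close> is infinite, so is the right-hand
  side, as \<open>C > 0\<close>; if \<open>b\<close> is finite, then so is \<open>a\<close>, as
  \<open>t powr p > 0\<close>.\<close>

lemma mult_epowr_root_le: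
  assumes "ennreal (t powr p) * a \<le> ennreal C * b" "t > 0" "C > 0" "p > 0"
  shows "ennreal t * epowr a (1 / p) \<le> ennreal (C powr (1 / p)) * epowr b (1 / p)"
proof (cases b)
  case top
  thus ?thesis
    using assms by (simp add: epowr_def ennreal_mult_top)
next
  case (real b')
  hence "ennreal (t powr p) * a < top"
    using assms(1) by (metis ennreal_mult ennreal_less_top assms(3) less_imp_le le_less_trans)
  then obtain a' where a': "a = ennreal a'" "a' \<ge> 0"
    using assms(2) by (cases a) (auto simp: ennreal_mult_top)
  have "t powr p * a' \<le> C * b'"
    using assms real a' by (simp flip: ennreal_mult)
  hence "(t powr p * a') powr (1 / p) \<le> (C * b') powr (1 / p)"
    using assms a' by (intro powr_mono2) auto
  hence "t * a' powr (1 / p) \<le> C powr (1 / p) * b' powr (1 / p)"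
    using assms a' real by (simp add: powr_mult powr_powr)
  thus ?thesis
    using assms a' real by (simp add: epowr_ennreal flip: ennreal_mult)
qed

lemma sum_le_infsum_ennreal:
  fixes g :: "'a \<Rightarrow> ennreal"
  assumes "finite F" "F \<subseteq> A"
  shows "sum g F \<le> infsum g A"
  unfolding infsum_finite[OF assms(1), symmetric]
  using assms by (intro infsum_mono_neutral nonneg_summable_on_complete) auto

text \<open>The measure of the level set is the supremum over its finite subsets, to which the
  finite estimate applies with one and the same \<open>C\<close>.\<close>

lemma weak_type_wmeasure:
  assumes k: "k \<ge> 2" and p: "p > 1"
  obtains C where "C > 0"
    "\<And>(f :: nat list \<Rightarrow> 'a::real_normed_field) t. t > 0 \<Longrightarrow>
      ennreal (t powr p) * wmeasure (level_weight k p) {x \<in> tree k. maximal k f x > ennreal t} \<le>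
      ennreal C * (\<Sum>\<^sub>\<infinity>x\<in>tree k. epowr (ennreal (norm (f x))) p * ennreal (level_weight k p x))"
proof -
  obtain C where C: "C > 0" and weak:
    "\<And>(f :: nat list \<Rightarrow> 'a) t F. t > 0 \<Longrightarrow> finite F \<Longrightarrow>
      F \<subseteq> {x \<in> tree k. maximal k f x > ennreal t} \<Longrightarrow>
      \<exists>n. t powr p * sum (tree_weight k p) F \<le>
        C * (\<Sum>y | y \<in> tree k \<and> length y < n. tree_weight k p y * norm (f y) powr p)"
    using weak_type_finite[OF k p, where 'a = 'a] by blast
  have w0: "tree_weight k p x \<ge> 0" for x
    by (simp add: tree_weight_def)
  show ?thesis
  proof (rule that[OF C])
    fix f :: "nat list \<Rightarrow> 'a" and t :: real
    assume t: "t > 0"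
    define E where "E = {x \<in> tree k. maximal k f x > ennreal t}"
    define I where
      "I = (\<Sum>\<^sub>\<infinity>x\<in>tree k. epowr (ennreal (norm (f x))) p * ennreal (level_weight k p x))"
    have "ennreal (t powr p) * wmeasure (level_weight k p) E =
        (SUP F\<in>{F. finite F \<and> F \<subseteq> E}. ennreal (t powr p) * (\<Sum>x\<in>F. ennreal (level_weight k p x)))"
      unfolding wmeasure_def
      by (subst nonneg_infsum_complete) (auto intro!: SUP_mult_left_ennreal)
    also have "\<dots> \<le> ennreal C * I"
    proof (rule SUP_least)
      fix F assume F: "F \<in> {F. finite F \<and> F \<subseteq> E}"
      then obtain n where n: "t powr p * sum (tree_weight k p) F \<le>
          C * (\<Sum>y | y \<in> tree k \<and> length y < n. tree_weight k p y * norm (f y) powr p)"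
        using weak[OF t, of F f] by (auto simp: E_def)
      let ?T = "{y \<in> tree k. length y < n}"
      have "(\<Sum>x\<in>F. ennreal (level_weight k p x)) = (\<Sum>x\<in>F. ennreal (tree_weight k p x))"
        using F by (intro sum.cong) (auto simp: E_def level_weight_eq)
      hence "ennreal (t powr p) * (\<Sum>x\<in>F. ennreal (level_weight k p x)) =
          ennreal (t powr p * sum (tree_weight k p) F)"
        using w0 by (simp add: sum_nonneg ennreal_mult)
      also have "\<dots> \<le> ennreal (C * (\<Sum>y\<in>?T. tree_weight k p y * norm (f y) powr p))"
        using n by (rule ennreal_leI)
      also have "\<dots> = ennreal C * (\<Sum>y\<in>?T. ennreal (tree_weight k p y * norm (f y) powr p))"
        using C w0 by (subst sum_ennreal) (auto simp: ennreal_mult sum_nonneg)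
      also have "(\<Sum>y\<in>?T. ennreal (tree_weight k p y * norm (f y) powr p)) =
          (\<Sum>y\<in>?T. epowr (ennreal (norm (f y))) p * ennreal (level_weight k p y))"
        using w0 by (intro sum.cong refl)
          (auto simp: epowr_ennreal level_weight_eq ennreal_mult mult.commute)
      also have "ennreal C * \<dots> \<le> ennreal C * I"
        unfolding I_def by (intro mult_left_mono sum_le_infsum_ennreal finite_tree_below) auto
      finally show "ennreal (t powr p) * (\<Sum>x\<in>F. ennreal (level_weight k p x)) \<le> ennreal C * I" .
    qed
    finally show "ennreal (t powr p) * wmeasure (level_weight k p) {x \<in> tree k. maximal k f x > ennreal t} \<le>
      ennreal C * (\<Sum>\<^sub>\<infinity>x\<in>tree k. epowr (ennreal (norm (f x))) p * ennreal (level_weight k p x))"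
      unfolding E_def I_def .
  qed
qed

lemma weak_type:
  assumes k: "k \<ge> 2" and p: "p > 1"
  shows "\<exists>C::real. C \<ge> 0 \<and> (\<forall>f :: nat list \<Rightarrow> 'a::real_normed_field.
    weak_Lp_norm k p (level_weight k p) (maximal k f) \<le>
      ennreal C * Lp_norm k p (level_weight k p) (\<lambda>x. ennreal (norm (f x))))"
proof -
  obtain C where C: "C > 0" and weak: "\<And>(f :: nat list \<Rightarrow> 'a) t. t > 0 \<Longrightarrow>
      ennreal (t powr p) * wmeasure (level_weight k p) {x \<in> tree k. maximal k f x > ennreal t} \<le>
      ennreal C * (\<Sum>\<^sub>\<infinity>x\<in>tree k. epowr (ennreal (norm (f x))) p * ennreal (level_weight k p x))"
    using weak_type_wmeasure[OF k p, where 'a = 'a] by blast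
  have "weak_Lp_norm k p (level_weight k p) (maximal k f) \<le>
      ennreal (C powr (1 / p)) * Lp_norm k p (level_weight k p) (\<lambda>x. ennreal (norm (f x)))"
    for f :: "nat list \<Rightarrow> 'a"
    unfolding weak_Lp_norm_def Lp_norm_def
    using C p by (intro SUP_least mult_epowr_root_le weak) auto
  thus ?thesis
    by (intro exI[of _ "C powr (1 / p)"]) auto
qed

section \<open>Failure of the strong-type estimate\<close>

text \<open>The ball of radius \<open>length x\<close> contains the root, so its average is the
  reciprocal of its cardinality.\<close>

lemma maximal_root_ge:
  assumes k: "k \<ge> 2" and x: "x \<in> tree k"
  defines "s \<equiv> sqrt (real k)"
  shows "maximal k (\<lambda>y. if y = [] then 1 else (0 :: 'a::real_normed_field)) x \<ge>
    ennreal (1 / ((s / (s - 1))\<^sup>2 * real k ^ length x))"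
proof -
  let ?f = "\<lambda>y. if y = [] then 1 else (0 :: 'a)" and ?B = "tree_ball k x (length x)"
  have "(\<Sum>y\<in>?B. norm (?f y)) = (\<Sum>y\<in>?B. if y = [] then 1 else 0)"
    by (intro sum.cong) auto
  also have "\<dots> = 1"
    using Nil_in_tree_ball[OF x] finite_tree_ball[OF x] by simp
  finally have *: "(\<Sum>y\<in>?B. norm (?f y)) = 1" .
  have "card ?B > 0"
    using Nil_in_tree_ball[OF x] finite_tree_ball[OF x] by (auto simp: card_gt_0_iff)
  hence "1 / ((s / (s - 1))\<^sup>2 * real k ^ length x) \<le> (\<Sum>y\<in>?B. norm (?f y)) / real (card ?B)"
    unfolding * using card_tree_ball_le[OF k x, of "length x"] k unfolding s_def
    by (intro divide_left_mono mult_pos_pos) auto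
  thus ?thesis
    unfolding maximal_def by (intro SUP_upper2[of "length x"] ennreal_leI) auto
qed

lemma Lp_norm_root:
  assumes "p > 0"
  shows "Lp_norm k p (level_weight k p)
    (\<lambda>x. ennreal (norm (if x = [] then 1 else (0 :: 'a::real_normed_field)))) \<le> 1"
proof -
  have "(\<Sum>\<^sub>\<infinity>x\<in>tree k. epowr (ennreal (norm (if x = [] then 1 else (0 :: 'a)))) p *
        ennreal (level_weight k p x)) =
      (\<Sum>\<^sub>\<infinity>x\<in>{[]}. epowr (ennreal (norm (if x = [] then 1 else (0 :: 'a)))) p *
        ennreal (level_weight k p x))"
    by (intro infsum_cong_neutral) (auto simp: Nil_in_tree epowr_def)
  also have "\<dots> \<le> 1"
    by (simp add: epowr_def level_weight_eq Nil_in_tree tree_weight_def)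
  finally have "Lp_norm k p (level_weight k p)
      (\<lambda>x. ennreal (norm (if x = [] then 1 else (0 :: 'a)))) \<le> epowr 1 (1 / p)"
    unfolding Lp_norm_def using assms by (intro epowr_mono) auto
  thus ?thesis
    by (simp add: epowr_def)
qed

lemma Lp_norm_maximal_root:
  assumes k: "k \<ge> 2" and p: "p > 1"
  shows "Lp_norm k p (level_weight k p)
    (maximal k (\<lambda>y. if y = [] then 1 else (0 :: 'a::real_normed_field))) = \<infinity>"
proof -
  define K where "K = (sqrt (real k) / (sqrt (real k) - 1))\<^sup>2"
  have K: "K > 0"
    using k by (simp add: K_def)
  let ?M = "maximal k (\<lambda>y. if y = [] then 1 else (0 :: 'a))"
  let ?I = "\<Sum>\<^sub>\<infinity>x\<in>tree k. epowr (?M x) p * ennreal (level_weight k p x)"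
  define c where "c = (1 / K) powr p"
  have c: "c > 0"
    using K by (simp add: c_def)
  \<comment> \<open>A lower bound for the summand of the strong norm. The exponents
    \<open>- p * n\<close> and \<open>(p - 1) * n\<close> add up to \<open>- n\<close>, so the
    \<open>k ^ n\<close> vertices of level \<open>n\<close> together contribute
    \<open>c\<close>.\<close>
  define h where "h = (\<lambda>x. (1 / (K * real k ^ length x)) powr p * tree_weight k p x)"
  have h: "h x = c / real k ^ length x" for x
  proof -
    have "(1 / (K * real k ^ length x)) powr p = c * real k powr (- (p * real (length x)))"
      using K k by (simp add: c_def powr_divide powr_mult powr_powr powr_minus_divide mult.commute
          flip: powr_realpow)
    hence "h x = c * (real k powr (- (p * real (length x))) * real k powr ((p - 1) * real (length x)))"
      by (simp add: h_def tree_weight_def)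
    also have "\<dots> = c * real k powr (- real (length x))"
      by (simp add: powr_add[symmetric] algebra_simps)
    finally show ?thesis
      using k by (simp add: powr_minus_divide powr_realpow)
  qed
  have ge: "epowr (?M x) p * ennreal (level_weight k p x) \<ge> ennreal (h x)" if x: "x \<in> tree k" for x
  proof -
    have "ennreal ((1 / (K * real k ^ length x)) powr p) = epowr (ennreal (1 / (K * real k ^ length x))) p"
      using K by (simp add: epowr_ennreal)
    also have "\<dots> \<le> epowr (?M x) p"
      using maximal_root_ge[OF k x, where 'a = 'a] p unfolding K_def by (intro epowr_mono) auto
    finally show ?thesis
      using x by (simp add: h_def level_weight_eq ennreal_mult tree_weight_def mult_right_mono)
  qed
  have "ennreal (real N * c) \<le> ?I" for N
  proof -
    have sub: "(\<Union>n<N. descendants k n []) \<subseteq> tree k"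
      by (auto simp: mem_descendants_iff Nil_in_tree)
    have "(\<Sum>x\<in>(\<Union>n<N. descendants k n []). h x) = (\<Sum>n<N. \<Sum>x\<in>descendants k n []. h x)"
      by (rule sum.UNION_disjoint) (simp, simp add: finite_descendants, auto simp: descendants_def)
    also have "\<dots> = (\<Sum>n<N. \<Sum>x\<in>descendants k n []. c / real k ^ n)"
      by (intro sum.cong refl) (auto simp: h descendants_def)
    also have "\<dots> = real N * c"
      using k by (simp add: card_descendants)
    finally have "ennreal (real N * c) = (\<Sum>x\<in>(\<Union>n<N. descendants k n []). ennreal (h x))"
      by (subst sum_ennreal) (auto simp: h_def tree_weight_def)
    also have "\<dots> \<le> (\<Sum>x\<in>(\<Union>n<N. descendants k n []). epowr (?M x) p * ennreal (level_weight k p x))"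
      using sub ge by (intro sum_mono) auto
    also have "\<dots> \<le> ?I"
      using sub by (intro sum_le_infsum_ennreal) (auto simp: finite_descendants)
    finally show ?thesis .
  qed
  hence "?I = \<infinity>"
  proof (cases ?I)
    case (real I)
    obtain N :: nat where "I / c < real N"
      using reals_Archimedean2 by blast
    hence "I < real N * c"
      using c by (simp add: field_simps)
    moreover have "real N * c \<le> I"
      using \<open>ennreal (real N * c) \<le> ?I\<close> real by simp
    ultimately show ?thesis
      by simp
  qed simp
  thus ?thesis
    by (simp add: Lp_norm_def epowr_def)
qed

theorem proposition3p2:
  fixes k :: nat and p :: real
  assumes "k \<ge> 2" and "1 < p"
  defines "w \<equiv> level_weight k p"
  shows "(\<exists>C::real. C \<ge> 0 \<and> (\<forall>f :: nat list \<Rightarrow> 'a::real_normed_field.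
            weak_Lp_norm k p w (maximal k f) \<le> ennreal C * Lp_norm k p w (\<lambda>x. ennreal (norm (f x)))))
       \<and> \<not> (\<exists>C::real. C \<ge> 0 \<and> (\<forall>f :: nat list \<Rightarrow> 'a.
            Lp_norm k p w (maximal k f) \<le> ennreal C * Lp_norm k p w (\<lambda>x. ennreal (norm (f x)))))"
proof
  show "\<exists>C::real. C \<ge> 0 \<and> (\<forall>f :: nat list \<Rightarrow> 'a::real_normed_field.
            weak_Lp_norm k p w (maximal k f) \<le> ennreal C * Lp_norm k p w (\<lambda>x. ennreal (norm (f x))))"
    unfolding w_def by (rule weak_type[OF assms(1,2)])
  show "\<not> (\<exists>C::real. C \<ge> 0 \<and> (\<forall>f :: nat list \<Rightarrow> 'a.
            Lp_norm k p w (maximal k f) \<le> ennreal C * Lp_norm k p w (\<lambda>x. ennreal (norm (f x)))))"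
  proof
    assume "\<exists>C::real. C \<ge> 0 \<and> (\<forall>f :: nat list \<Rightarrow> 'a.
            Lp_norm k p w (maximal k f) \<le> ennreal C * Lp_norm k p w (\<lambda>x. ennreal (norm (f x))))"
    then obtain C :: real where C: "Lp_norm k p w (maximal k f) \<le>
        ennreal C * Lp_norm k p w (\<lambda>x. ennreal (norm (f x)))" for f :: "nat list \<Rightarrow> 'a"
      by blast
    have "\<infinity> \<le> ennreal C * Lp_norm k p w (\<lambda>x. ennreal (norm (if x = [] then 1 else (0 :: 'a))))"
      using C[of "\<lambda>x. if x = [] then 1 else 0"] Lp_norm_maximal_root[OF assms(1,2), where 'a = 'a]
      unfolding w_def by simp
    also have "\<dots> \<le> ennreal C * 1"
      unfolding w_def using assms(2) by (intro mult_left_mono Lp_norm_root) auto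
    finally show False
      by (simp add: top_unique)
  qed
qed

end
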